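(* Let $T$ be a tree on $n \ge 2$ vertices with $\ell$ leaves and $s$ support vertices. Then $$\left \lceil \frac{n-\ell-s+4}{5} \right \rceil \leq \gamma_2^2(T) \leq \left \lfloor \frac{n+3s-1}{5} \right \rfloor.$$
   Context: A leaf is a vertex of degree 1; a support vertex is a vertex adjacent to a leaf. $\gamma_2^2(T)$ is the minimum size of a set $X\subseteq V(T)$ such that every vertex not in $X$ is at distance at most $2$ from some vertex of $X$, and any two distinct vertices of $X$ are at distance at least $3$ in $T$ (equivalently, the minimum size of a maximal $2$-packing). *)

theory Defs
  imports "Graph_Theory.Digraph_Component" "Graph_Theory.Shortest_Path"
begin

text \<open>
  Finite simple graphs are modelled as in Graph_Theory, by the locale \<open>pair_graph\<close> of finite
  loop-free symmetric digraphs whose arcs are pairs of vertices; an undirected edge \<open>uv\<close> is the pair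
  of arcs \<open>(u, v)\<close>, \<open>(v, u)\<close>.  The predicate \<^const>\<open>tree\<close> of that library is unsuitable for
  symmetric digraphs: it counts the closed walk \<open>u, v, u\<close> as a cycle, so no symmetric digraph with
  an arc satisfies it.  In a simple graph the undirected cycles are precisely those of length at
  least 3.
\<close>

definition graph_tree :: "'a pair_pre_digraph \<Rightarrow> bool" where
  "graph_tree G \<longleftrightarrow>
     pair_graph G \<and> connected (with_proj G) \<and>
     \<not> (\<exists>p. pre_digraph.cycle (with_proj G) p \<and> 3 \<le> length p)"

definition leaves :: "'a pair_pre_digraph \<Rightarrow> 'a set" where
  "leaves G = {v \<in> pverts G. out_degree (with_proj G) v = 1}"

definition support_vertices :: "'a pair_pre_digraph \<Rightarrow> 'a set" where
  "support_vertices G = {v \<in> pverts G. \<exists>u \<in> leaves G. v \<rightarrow>\<^bsub>with_proj G\<^esub> u}"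

definition graph_dist :: "'a pair_pre_digraph \<Rightarrow> 'a \<Rightarrow> 'a \<Rightarrow> ereal" where
  "graph_dist G u v = wf_digraph.\<mu> (with_proj G) (\<lambda>_. 1) u v"

definition dominating_within_2 :: "'a pair_pre_digraph \<Rightarrow> 'a set \<Rightarrow> bool" where
  "dominating_within_2 G X \<longleftrightarrow> (\<forall>v \<in> pverts G - X. \<exists>x \<in> X. graph_dist G v x \<le> 2)"

definition two_packing :: "'a pair_pre_digraph \<Rightarrow> 'a set \<Rightarrow> bool" where
  "two_packing G X \<longleftrightarrow> (\<forall>x \<in> X. \<forall>y \<in> X. x \<noteq> y \<longrightarrow> 3 \<le> graph_dist G x y)"

definition gamma_2_2 :: "'a pair_pre_digraph \<Rightarrow> nat" where
  "gamma_2_2 G = Min (card ` {X. X \<subseteq> pverts G \<and> dominating_within_2 G X \<and> two_packing G X})"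

end

theory Submission
  imports Defs
begin

text \<open>
  Lower bound. Let \<open>X\<close> be a distance-2 dominating set of size \<open>k\<close>, and let every vertex outside \<open>X\<close> point to
  a neighbour that is nearer to \<open>X\<close>. These pointers use \<open>n - k\<close> of the \<open>n - 1\<close> edges, so \<open>k - 1\<close> edges, that is
  \<open>2 (k - 1)\<close> arcs, are unused. A vertex outside \<open>X\<close> that is neither a leaf nor a support vertex is the tail
  of an unused arc, or some vertex pointing to it is. Hence there are at most \<open>k + 4 (k - 1)\<close> vertices
  that are neither leaves nor support vertices.

  Upper bound, by induction on \<open>n\<close>. Root the tree at a leaf, take a deepest vertex, and let \<open>b\<close>, \<open>b'\<close>, \<open>b''\<close> be
  its grandparent and the next two ancestors. Let \<open>t\<close> be the number of non-leaf children of \<open>b\<close>; the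
  subtree at \<open>b\<close> has at least \<open>2 t + 1\<close> vertices and \<open>t\<close> support vertices. A maximal packing of the tree
  without this subtree, or without the subtree at \<open>b'\<close> if \<open>b\<close> is the only child of \<open>b'\<close>, extends to the whole
  tree by at most \<open>t\<close> vertices. This suffices unless the removal creates a new support vertex. If both
  removals do, then \<open>b'\<close> and \<open>b''\<close> have degree 2; removing the subtree at \<open>b''\<close> then costs the single new
  packing vertex \<open>b\<close> and at most one new support vertex, and it removes at least \<open>2 t + 3\<close> vertices.
\<close>

section \<open>Trees given by a parent map\<close>

text \<open>Since the root is its own parent, this says that \<open>u\<close> and \<open>v\<close> are at distance at most 2, and it
  does not mention the vertex set: packings survive the removal of subtrees.\<close>

definition pnear :: "('a \<Rightarrow> 'a) \<Rightarrow> 'a \<Rightarrow> 'a \<Rightarrow> bool" where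
  "pnear p u v \<longleftrightarrow> p u = p v \<or> p (p u) = v \<or> p (p v) = u \<or> p u = v \<or> p v = u"

text \<open>The support vertices of a tree whose root is itself a leaf.\<close>

definition psupports :: "'a set \<Rightarrow> 'a \<Rightarrow> ('a \<Rightarrow> 'a) \<Rightarrow> 'a set" where
  "psupports V r p =
     p ` {u \<in> V. u \<noteq> r \<and> (\<forall>w \<in> V. p w \<noteq> u)} \<union> {c \<in> V. c \<noteq> r \<and> p c = r}"

lemma pnear_commute: "pnear p u v \<longleftrightarrow> pnear p v u"
  unfolding pnear_def by metis

text \<open>\<open>pnear\<close> is reflexive, so members of \<open>X\<close> dominate themselves
  and \<open>A\<close> may overlap \<open>X\<close>. A separate \<open>A\<close> lets domination be
  checked on the kept and on the removed part in turn.\<close>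

definition pdominates :: "('a \<Rightarrow> 'a) \<Rightarrow> 'a set \<Rightarrow> 'a set \<Rightarrow> bool" where
  "pdominates p X A \<longleftrightarrow> (\<forall>v \<in> A. \<exists>x \<in> X. pnear p v x)"

definition ppacking :: "('a \<Rightarrow> 'a) \<Rightarrow> 'a set \<Rightarrow> bool" where
  "ppacking p X \<longleftrightarrow> (\<forall>x \<in> X. \<forall>y \<in> X. x \<noteq> y \<longrightarrow> \<not> pnear p x y)"

lemma ppacking_Un:
  assumes "ppacking p X" "ppacking p Y" "\<And>x y. x \<in> X \<Longrightarrow> y \<in> Y \<Longrightarrow> \<not> pnear p x y"
  shows "ppacking p (X \<union> Y)"
  using assms pnear_commute unfolding ppacking_def by (metis UnE)

text \<open>The inequality is the upper bound cleared of its floor, its division and its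
  subtraction.\<close>

definition small_packing :: "'a set \<Rightarrow> 'a \<Rightarrow> ('a \<Rightarrow> 'a) \<Rightarrow> 'a set \<Rightarrow> bool" where
  "small_packing V r p X \<longleftrightarrow> X \<subseteq> V \<and> ppacking p X \<and> pdominates p X V \<and>
     5 * card X + 1 \<le> card V + 3 * card (psupports V r p)"

text \<open>The depth \<open>h\<close> excludes cycles of \<open>p\<close> and forces every vertex
  to reach \<open>r\<close> by iterating \<open>p\<close>; \<open>p\<close> maps \<open>r\<close> to
  itself, so its iterates never leave \<open>V\<close>.\<close>

locale rooted_tree =
  fixes V :: "'a set" and r :: 'a and p :: "'a \<Rightarrow> 'a" and h :: "'a \<Rightarrow> nat"
  assumes finite_V: "finite V"
    and root_in: "r \<in> V"
    and parent_root: "p r = r"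
    and parent_in: "v \<in> V \<Longrightarrow> p v \<in> V"
    and depth_root: "h r = 0"
    and depth_parent: "v \<in> V \<Longrightarrow> v \<noteq> r \<Longrightarrow> h v = Suc (h (p v))"
begin

lemma depth_parent_eq: "v \<in> V \<Longrightarrow> h (p v) = h v - 1"
  using depth_parent parent_root depth_root by (cases "v = r") auto

lemma depth_eq_0: "v \<in> V \<Longrightarrow> h v = 0 \<longleftrightarrow> v = r"
  using depth_root depth_parent by (metis nat.distinct(1))

lemma parent_neq: "v \<in> V \<Longrightarrow> v \<noteq> r \<Longrightarrow> p v \<noteq> v"
  using depth_parent by fastforce

end

locale leaf_rooted_tree = rooted_tree +
  assumes root_leaf: "\<exists>!c. c \<in> V \<and> c \<noteq> r \<and> p c = r"
begin

lemma psupports_subset: "psupports V r p \<subseteq> V"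
  unfolding psupports_def using parent_in by auto

lemma finite_psupports: "finite (psupports V r p)"
  using finite_subset[OF psupports_subset finite_V] .

text \<open>The third iterate of \<open>p\<close> at such a vertex is \<open>r\<close>. As
  \<open>r\<close> has only one child, the last vertex before \<open>r\<close> on the way up is
  \<open>c\<close>, which is thus at most two steps away.\<close>

lemma pnear_root_child:
  assumes "c \<in> V" "c \<noteq> r" "p c = r" "v \<in> V" "h v \<le> 3"
  shows "pnear p v c"
proof -
  have uniq: "u = c" if "u \<in> V" "u \<noteq> r" "p u = r" for u
    using root_leaf that assms by blast
  have pv: "p v \<in> V" "p (p v) \<in> V" "p (p (p v)) \<in> V"
    using assms parent_in by auto
  have "p (p (p v)) = r"
    using assms(4,5) depth_parent_eq pv by (subst depth_eq_0[symmetric]) auto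
  then show ?thesis
    using uniq[OF assms(4)] uniq[OF pv(1)] uniq[OF pv(2)] assms(3) unfolding pnear_def by metis
qed

text \<open>This is the bound for a packing of size one: 6 = 5 * 1 + 1. On two vertices both are
  support vertices; otherwise three vertices and one support vertex suffice.\<close>

lemma six_le_card:
  "6 \<le> card V + 3 * card (psupports V r p)"
proof -
  obtain c where c: "c \<in> V" "c \<noteq> r" "p c = r" using root_leaf by blast
  have cs: "c \<in> psupports V r p" unfolding psupports_def using c by auto
  show ?thesis
  proof (cases "V = {r, c}")
    case True
    have "r \<in> psupports V r p"
      unfolding psupports_def using c True parent_root by (auto intro!: image_eqI[of _ _ c])
    then have "card {r, c} \<le> card (psupports V r p)"
      using cs by (intro card_mono finite_psupports) auto
    then show ?thesis using c True by simp
  next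
    case False
    then obtain d where "d \<in> V" "d \<noteq> r" "d \<noteq> c" using c root_in by blast
    then have "card {r, c, d} \<le> card V"
      using c root_in by (intro card_mono finite_V) auto
    moreover have "card {r, c, d} = 3" using c \<open>d \<noteq> r\<close> \<open>d \<noteq> c\<close> by auto
    moreover have "card (psupports V r p) > 0"
      using cs finite_psupports by (auto simp: card_gt_0_iff)
    ultimately show ?thesis by linarith
  qed
qed

text \<open>\<open>S\<close> is a union of subtrees hanging from \<open>w\<close>. Only
  \<open>w\<close> loses children, so it is the only possible new leaf and its parent the only
  possible new support vertex.\<close>

lemma prune:
  assumes "r \<notin> S" "w \<in> V - S" "w \<noteq> r"
    and down: "\<And>u. u \<in> V \<Longrightarrow> p u \<in> S \<Longrightarrow> u \<in> S"
    and up: "\<And>u. u \<in> S \<Longrightarrow> p u \<in> insert w S"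
  shows "leaf_rooted_tree (V - S) r p h"
    and "psupports (V - S) r p \<subseteq>
      (psupports V r p - S) \<union> (if \<exists>u \<in> V - S. p u = w then {} else {p w})"
proof -
  obtain c where c: "c \<in> V" "c \<noteq> r" "p c = r" using root_leaf by blast
  \<comment> \<open>If the only child of the root were removed, \<open>r\<close> would be
    \<open>w\<close> or lie in \<open>S\<close>.\<close>
  have "c \<notin> S" using up c assms(1,3) by force
  show "leaf_rooted_tree (V - S) r p h"
  proof
    show "\<exists>!c. c \<in> V - S \<and> c \<noteq> r \<and> p c = r"
      using root_leaf c \<open>c \<notin> S\<close> by (metis DiffD1 DiffI)
  qed (use assms finite_V root_in parent_root parent_in depth_root depth_parent in auto)
  show "psupports (V - S) r p \<subseteq>
      (psupports V r p - S) \<union> (if \<exists>u \<in> V - S. p u = w then {} else {p w})"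
  proof
    fix y assume "y \<in> psupports (V - S) r p"
    then consider (leaf) u where "u \<in> V - S" "u \<noteq> r" "\<forall>z \<in> V - S. p z \<noteq> u" "y = p u"
      | (root) "y \<in> V - S" "y \<noteq> r" "p y = r"
      unfolding psupports_def by blast
    then show "y \<in> (psupports V r p - S) \<union> (if \<exists>u \<in> V - S. p u = w then {} else {p w})"
    proof cases
      case leaf
      show ?thesis
      proof (cases "u = w")
        case True
        then show ?thesis using leaf by auto
      next
        case False
        have "\<forall>z \<in> V. p z \<noteq> u" using leaf False up by blast
        then have "y \<in> psupports V r p" unfolding psupports_def using leaf by blast
        then show ?thesis using leaf down by blast
      qed
    next
      case root
      then show ?thesis unfolding psupports_def by auto
    qed
  qed
qed

end

section \<open>Pruning a deepest branch\<close>

text \<open>The subtree below \<open>b\<close> has height exactly 2: \<open>b\<close> is the grandparent of a deepest vertex.\<close>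

locale deepest_branch = leaf_rooted_tree +
  fixes b
  assumes b_in: "b \<in> V" and b_neq: "b \<noteq> r"
    and b_height_ge: "\<exists>u \<in> V. p (p u) = b"
    and b_height_le: "u \<in> V \<Longrightarrow> p (p (p u)) \<noteq> b"
begin

text \<open>By \<open>b_height_le\<close> this is the whole subtree at \<open>b\<close>.\<close>

definition branch where "branch = {u \<in> V. u = b \<or> p u = b \<or> p (p u) = b}"
text \<open>The number of forks is the \<open>t\<close> of the overview; children of forks are
  leaves, again by \<open>b_height_le\<close>.\<close>

definition forks where "forks = {c \<in> V. p c = b \<and> (\<exists>u \<in> V. p u = c)}"
definition twig where "twig c = (SOME u. u \<in> V \<and> p u = c)"

lemma twig: assumes "c \<in> forks" shows "twig c \<in> V" "p (twig c) = c"
proof -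
  have "\<exists>u. u \<in> V \<and> p u = c" using assms unfolding forks_def by blast
  from someI_ex[OF this] show "twig c \<in> V" "p (twig c) = c" unfolding twig_def by auto
qed

lemma b_not_parent: "p b \<noteq> b" "p (p b) \<noteq> b"
proof -
  show "p b \<noteq> b" using parent_neq b_in b_neq by auto
  show "p (p b) \<noteq> b"
    using depth_parent_eq[of b] depth_parent_eq[of "p b"] parent_in b_in b_neq depth_eq_0[of b]
    by fastforce
qed

lemma finite_forks: "finite forks" using finite_V unfolding forks_def by simp
lemma forks_nonempty: "forks \<noteq> {}" using b_height_ge parent_in unfolding forks_def by blast
lemma forks_subset: "forks \<subseteq> branch" unfolding forks_def branch_def by auto
lemma forksD: "c \<in> forks \<Longrightarrow> c \<in> V \<and> p c = b" unfolding forks_def by auto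
lemma inj_twig: "inj_on twig forks" using twig by (metis inj_onI)

lemma branch_down: "u \<in> V \<Longrightarrow> p u \<in> branch \<Longrightarrow> u \<in> branch"
  using b_height_le unfolding branch_def by auto

lemma branch_up: "u \<in> branch \<Longrightarrow> p u \<in> insert (p b) branch"
  unfolding branch_def using parent_in by auto

lemma root_notin_branch: "r \<notin> branch"
  using parent_root b_neq unfolding branch_def by auto

lemma parent_notin_branch: "p b \<notin> branch"
proof
  assume "p b \<in> branch"
  then have "p (p (p b)) = b" using b_not_parent unfolding branch_def by auto
  then show False using b_height_le b_in by auto
qed

text \<open>The vertex \<open>b\<close>, the forks and one twig per fork are all distinct.\<close>

lemma card_branch: "2 * card forks + 1 \<le> card branch"
proof -
  have disj: "forks \<inter> twig ` forks = {}"
  proof -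
    have "twig c \<notin> forks" if "c \<in> forks" for c
    proof
      assume "twig c \<in> forks"
      then have "c = b" using forksD twig that by metis
      then show False using that forksD b_not_parent by blast
    qed
    then show ?thesis by auto
  qed
  have nb: "b \<notin> forks \<union> twig ` forks"
  proof
    assume "b \<in> forks \<union> twig ` forks"
    then show False
    proof
      assume "b \<in> forks" then show False using forksD b_not_parent by blast
    next
      assume "b \<in> twig ` forks"
      then obtain c where "c \<in> forks" "b = twig c" by auto
      then show False using twig forksD b_not_parent by metis
    qed
  qed
  have "card (insert b (forks \<union> twig ` forks)) = 2 * card forks + 1"
    using nb disj finite_forks card_image[OF inj_twig] by (simp add: card_Un_disjoint)
  moreover have "insert b (forks \<union> twig ` forks) \<subseteq> branch"
    using b_in forks_subset twig forksD unfolding branch_def by auto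
  moreover have "finite branch" unfolding branch_def using finite_V by simp
  ultimately show ?thesis using card_mono by metis
qed

lemma forks_supports: "forks \<subseteq> psupports V r p"
proof
  fix c assume c: "c \<in> forks"
  have "\<forall>w \<in> V. p w \<noteq> twig c" using c twig forksD b_height_le by metis
  moreover have "twig c \<noteq> r" using c twig forksD b_neq parent_root by metis
  ultimately show "c \<in> psupports V r p"
    unfolding psupports_def using twig[OF c] by force
qed

text \<open>These inequalities refute each clause of \<open>pnear\<close> between a vertex outside
  and a fork or twig inside. Four iterates are reached when the grandparent of \<open>x\<close> is
  supposed to be a twig.\<close>

lemma outside_branch:
  assumes "x \<in> V" "x \<notin> branch"
  shows "x \<noteq> b" "p x \<noteq> b" "p (p x) \<noteq> b" "p (p (p x)) \<noteq> b" "p (p (p (p x))) \<noteq> b"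
  using assms b_height_le parent_in unfolding branch_def by auto

lemma not_pnear_twig:
  assumes "c \<in> forks" "x \<in> V" "x \<notin> branch"
  shows "\<not> pnear p (twig c) x"
  using outside_branch[OF assms(2,3)] twig[OF assms(1)] forksD[OF assms(1)] unfolding pnear_def by metis

text \<open>A path from a fork out of the branch passes \<open>b\<close> and \<open>p b\<close>;
  within two steps it reaches only \<open>p b\<close>.\<close>

lemma not_pnear_fork:
  assumes "c \<in> forks" "x \<in> V" "x \<notin> branch" "x \<noteq> p b"
  shows "\<not> pnear p c x"
  using outside_branch[OF assms(2,3)] forksD[OF assms(1)] assms(4) unfolding pnear_def by metis

lemma not_pnear_twigs:
  assumes "c \<in> forks" "d \<in> forks" "c \<noteq> d"
  shows "\<not> pnear p (twig c) (twig d)"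
  using twig[OF assms(1)] twig[OF assms(2)] forksD[OF assms(1)] forksD[OF assms(2)] assms(3) b_not_parent
  unfolding pnear_def by metis

lemma not_pnear_fork_twig:
  assumes "c \<in> forks" "d \<in> forks" "c \<noteq> d"
  shows "\<not> pnear p c (twig d)"
  using twig[OF assms(2)] forksD[OF assms(1)] forksD[OF assms(2)] assms(3) b_not_parent
    b_height_le[OF b_in]
  unfolding pnear_def by metis

text \<open>Extensions of a packing outside the branch to one that dominates the branch; which of them applies
  depends on whether the ancestors of \<open>b\<close> belong to the packing.\<close>

lemma extend_by_fork:
  assumes X: "X \<subseteq> V - branch" "ppacking p X" and "p b \<notin> X"
  obtains Y where "Y \<subseteq> V" "X \<subseteq> Y" "ppacking p Y" "pdominates p Y (insert (p b) branch)"
    "card Y \<le> card X + card forks"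
proof -
  obtain c where c: "c \<in> forks" using forks_nonempty by blast
  \<comment> \<open>The fork \<open>c\<close> is near \<open>p b\<close>, \<open>b\<close>, all
    children of \<open>b\<close> and its own children. The children of any other fork are near the
    twig of that fork.\<close>
  define Z where "Z = insert c (twig ` (forks - {c}))"
  have "ppacking p Z"
    unfolding ppacking_def
  proof (intro ballI impI)
    fix x y assume "x \<in> Z" "y \<in> Z" "x \<noteq> y"
    then consider d where "x = c" "y = twig d" "d \<in> forks" "c \<noteq> d"
      | d where "y = c" "x = twig d" "d \<in> forks" "c \<noteq> d"
      | d e where "x = twig d" "y = twig e" "d \<in> forks" "e \<in> forks" "d \<noteq> e"
      unfolding Z_def by auto
    then show "\<not> pnear p x y"
      by cases (use c not_pnear_twigs not_pnear_fork_twig pnear_commute[of p x y] in simp_all)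
  qed
  moreover have "\<not> pnear p x z" if "x \<in> X" "z \<in> Z" for x z
  proof -
    have x: "x \<in> V" "x \<notin> branch" "x \<noteq> p b" using that(1) X(1) assms(3) by auto
    then show ?thesis
      using that(2) not_pnear_twig not_pnear_fork[OF c] pnear_commute[of p x] unfolding Z_def by auto
  qed
  ultimately have "ppacking p (X \<union> Z)" using X(2) ppacking_Un by metis
  moreover have "X \<union> Z \<subseteq> V" using X(1) twig c forksD unfolding Z_def by auto
  moreover have "pdominates p (X \<union> Z) (insert (p b) branch)"
    unfolding pdominates_def
  proof
    fix v assume "v \<in> insert (p b) branch"
    then consider "v = p b" | "v = b" | "p v = b" | "p (p v) = b" "v \<in> V"
      unfolding branch_def by auto
    then show "\<exists>x \<in> X \<union> Z. pnear p v x"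
    proof cases
      case 4
      then have pv: "p v \<in> forks" unfolding forks_def using parent_in by auto
      show ?thesis
      proof (cases "p v = c")
        case True
        then show ?thesis unfolding Z_def pnear_def by auto
      next
        case False
        then have "twig (p v) \<in> Z" using pv unfolding Z_def by auto
        moreover have "pnear p v (twig (p v))" using twig pv unfolding pnear_def by metis
        ultimately show ?thesis by blast
      qed
    qed (use forksD[OF c] in \<open>auto simp: Z_def pnear_def\<close>)
  qed
  moreover have "card (X \<union> Z) \<le> card X + card forks"
  proof -
    have "card Z \<le> Suc (card (twig ` (forks - {c})))" unfolding Z_def by (rule card_insert_le_m1) auto
    also have "\<dots> \<le> Suc (card (forks - {c}))" using finite_forks card_image_le by auto
    also have "\<dots> = card forks" using finite_forks c by (metis card_Suc_Diff1)
    finally show ?thesis using card_Un_le[of X Z] by linarith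
  qed
  ultimately show ?thesis using that[of "X \<union> Z"] by blast
qed

lemma extend_by_twigs:
  assumes X: "X \<subseteq> V - branch" "ppacking p X" and "p b \<in> X"
  obtains Y where "Y \<subseteq> V" "X \<subseteq> Y" "ppacking p Y" "pdominates p Y branch"
    "card Y \<le> card X + card forks"
proof -
  \<comment> \<open>\<open>p b\<close> is already near \<open>b\<close> and its children, so only
    the grandchildren remain. A fork would be too close to \<open>p b\<close>, a twig is
    not.\<close>
  define Z where "Z = twig ` forks"
  have "ppacking p Z"
    using not_pnear_twigs unfolding ppacking_def Z_def by (auto 4 0)
  moreover have "\<not> pnear p x z" if "x \<in> X" "z \<in> Z" for x z
  proof -
    have x: "x \<in> V" "x \<notin> branch" using that(1) X(1) by auto
    then show ?thesis
      using that(2) not_pnear_twig pnear_commute[of p x] unfolding Z_def by auto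
  qed
  ultimately have "ppacking p (X \<union> Z)" using X(2) ppacking_Un by metis
  moreover have "X \<union> Z \<subseteq> V" using X(1) twig forksD unfolding Z_def by auto
  moreover have "pdominates p (X \<union> Z) branch"
    unfolding pdominates_def
  proof
    fix v assume "v \<in> branch"
    then consider "v = b" | "p v = b" | "p (p v) = b" "v \<in> V"
      unfolding branch_def by auto
    then show "\<exists>x \<in> X \<union> Z. pnear p v x"
    proof cases
      case 3
      then have pv: "p v \<in> forks" unfolding forks_def using parent_in by auto
      then have "twig (p v) \<in> Z" unfolding Z_def by auto
      moreover have "pnear p v (twig (p v))" using twig pv unfolding pnear_def by metis
      ultimately show ?thesis by blast
    qed (use assms(3) in \<open>auto simp: pnear_def\<close>)
  qed
  moreover have "card (X \<union> Z) \<le> card X + card forks"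
    using card_Un_le[of X Z] card_image_le[OF finite_forks, of twig] unfolding Z_def by linarith
  ultimately show ?thesis using that[of "X \<union> Z"] by blast
qed

lemma extend_by_top:
  assumes X: "X \<subseteq> V - branch" "ppacking p X" and "p b \<notin> X" "p (p b) \<notin> X"
    and only: "\<And>u. u \<in> X \<Longrightarrow> p u \<noteq> p b"
  obtains Y where "Y \<subseteq> V" "X \<subseteq> Y" "ppacking p Y"
    "pdominates p Y (insert (p (p b)) (insert (p b) branch))"
    "card Y \<le> card X + 1"
proof -
  \<comment> \<open>Outside the branch, \<open>b\<close> is near only \<open>p b\<close>,
    \<open>p (p b)\<close> and its siblings, which the hypotheses keep out of
    \<open>X\<close>.\<close>
  have "\<not> pnear p x b" if "x \<in> X" for x
    using outside_branch[of x] that assms unfolding pnear_def by (metis DiffD1 DiffD2 subsetD)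
  then have "ppacking p (X \<union> {b})"
    using X(2) by (intro ppacking_Un) (auto simp: ppacking_def)
  moreover have "pdominates p (X \<union> {b}) (insert (p (p b)) (insert (p b) branch))"
    unfolding pdominates_def branch_def pnear_def by auto
  moreover have "card (X \<union> {b}) \<le> card X + 1"
    using card_Un_le[of X "{b}"] by simp
  ultimately show ?thesis using that[of "X \<union> {b}"] X(1) b_in by blast
qed

text \<open>All forks are support vertices and disappear with \<open>R\<close>; \<open>A\<close>
  holds the at most \<open>k\<close> new support vertices.\<close>

lemma card_psupports_prune:
  assumes "branch \<subseteq> R" "psupports (V - R) r p \<subseteq> (psupports V r p - R) \<union> A" "card A \<le> k" "finite A"
  shows "card (psupports (V - R) r p) + card forks \<le> card (psupports V r p) + k"
proof -
  have "card (psupports (V - R) r p) \<le> card ((psupports V r p - R) \<union> A)"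
    using assms finite_psupports by (intro card_mono) auto
  also have "\<dots> \<le> card (psupports V r p - R) + k"
    using card_Un_le assms(3) by (meson add_left_mono le_trans)
  finally have 1: "card (psupports (V - R) r p) \<le> card (psupports V r p - R) + k" .
  have "card (psupports V r p - R) + card forks = card ((psupports V r p - R) \<union> forks)"
    using finite_psupports finite_forks forks_subset assms(1) by (subst card_Un_disjoint) auto
  also have "\<dots> \<le> card (psupports V r p)"
    using forks_supports finite_psupports by (intro card_mono) auto
  finally show ?thesis using 1 by linarith
qed

lemma small_packing_step:
  assumes IH: "\<And>R. leaf_rooted_tree (V - R) r p h \<Longrightarrow> card (V - R) < card V \<Longrightarrow>
      \<exists>X. small_packing (V - R) r p X"
    and pb: "p b \<noteq> r"
    and nosingle: "\<not> (\<exists>x \<in> V. \<forall>v \<in> V. pnear p v x)"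
  shows "\<exists>X. small_packing V r p X"
proof -
  have pbV: "p b \<in> V" "p (p b) \<in> V" "p (p (p b)) \<in> V" using b_in parent_in by auto
  have t: "card forks \<ge> 1" using forks_nonempty finite_forks by (simp add: Suc_leI card_gt_0_iff)
  have SV: "branch \<subseteq> V" unfolding branch_def by auto
  have card_diff: "card (V - R) = card V - card R" if "R \<subseteq> V" for R
    using that finite_V by (meson card_Diff_subset finite_subset)
  have cardV: "card R \<le> card V" if "R \<subseteq> V" for R
    using that finite_V card_mono by blast
  have finS: "finite branch" using SV finite_V finite_subset by blast
  have dom: "pdominates p Y V" if "pdominates p X (V - R)" "X \<subseteq> Y" "pdominates p Y R" for X Y R
    using that unfolding pdominates_def by blast
  have ppb: "p (p b) \<noteq> p b" using parent_neq pbV pb by auto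
  have ppbS: "p (p b) \<notin> branch" "p (p (p b)) \<notin> branch"
    using branch_down parent_notin_branch pbV by auto
  \<comment> \<open>Otherwise the tree would consist of \<open>r\<close>, \<open>p b\<close> and the
    branch, and \<open>b\<close> would be near every vertex.\<close>
  have ppbr: "p (p b) \<noteq> r" if only: "\<forall>u \<in> V - branch. p u \<noteq> p b"
  proof
    assume a: "p (p b) = r"
    have "v = r \<or> v = p b \<or> v \<in> branch" if "v \<in> V" for v
      using that
    proof (induction "h v" arbitrary: v)
      case 0
      then show ?case using depth_eq_0 by auto
    next
      case (Suc k)
      then have "p v \<in> V" "k = h (p v)" using depth_parent_eq parent_in by auto
      from Suc.hyps(1)[OF this(2,1)] show ?case
        using Suc.prems only branch_down root_leaf a pb pbV by (metis DiffI)
    qed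
    then have "pnear p v b" if "v \<in> V" for v
      using that a unfolding branch_def pnear_def by auto
    then show False using nosingle b_in by blast
  qed
  \<comment> \<open>The cases name removals that can be afforded: the branch if \<open>p b\<close>
    keeps a child or its parent is a support vertex already, the branch with \<open>p b\<close> if
    \<open>p (p b)\<close> keeps a child, and the branch with both otherwise.\<close>
  consider (prune2) "(\<exists>u \<in> V - branch. p u = p b) \<or> p (p b) \<in> psupports V r p - branch"
    | (prune3) "\<forall>u \<in> V - branch. p u \<noteq> p b" "p (p b) \<notin> psupports V r p - branch"
        "\<exists>u \<in> V. p u = p (p b) \<and> u \<noteq> p b"
    | (prune4) "\<forall>u \<in> V - branch. p u \<noteq> p b" "p (p b) \<notin> psupports V r p - branch"
        "\<forall>u \<in> V. p u = p (p b) \<longrightarrow> u = p b"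
    by blast
  then show ?thesis
  proof cases
    case prune2
    have prem: "r \<notin> branch" "p b \<in> V - branch" "p b \<noteq> r"
      using root_notin_branch parent_notin_branch pbV pb by auto
    note pr = prune[OF prem branch_down branch_up]
    have "psupports (V - branch) r p \<subseteq> (psupports V r p - branch) \<union> {}"
      using pr(2) prune2 by (auto split: if_splits)
    from card_psupports_prune[OF subset_refl this, of 0]
    have s: "card (psupports (V - branch) r p) + card forks \<le> card (psupports V r p)" by simp
    have n: "card (V - branch) + 2 * card forks + 1 \<le> card V"
      using card_diff[OF SV] cardV[OF SV] card_branch by linarith
    obtain X where X: "small_packing (V - branch) r p X" using IH[OF pr(1)] n by auto
    then have X': "X \<subseteq> V - branch" "ppacking p X" unfolding small_packing_def by auto
    obtain Y where Y: "Y \<subseteq> V" "X \<subseteq> Y" "ppacking p Y" "pdominates p Y branch"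
      "card Y \<le> card X + card forks"
    proof (cases "p b \<in> X")
      case True
      then show ?thesis using extend_by_twigs[OF X'] that by metis
    next
      case False
      obtain Y where "Y \<subseteq> V" "X \<subseteq> Y" "ppacking p Y" "pdominates p Y (insert (p b) branch)"
        "card Y \<le> card X + card forks" using extend_by_fork[OF X' False] .
      then show ?thesis using that unfolding pdominates_def by blast
    qed
    \<comment> \<open>With \<open>t\<close> forks, the new vertices cost at most \<open>5 t\<close>,
      while the right-hand side loses at least \<open>(2 t + 1) + 3 t\<close>.\<close>
    have "small_packing V r p Y"
      using X Y s n dom[of X branch Y] unfolding small_packing_def by auto
    then show ?thesis by blast
  next
    case prune3
    define R where "R = insert (p b) branch"
    have R: "R \<subseteq> V" using SV pbV unfolding R_def by auto
    have prem: "r \<notin> R" "p (p b) \<in> V - R" "p (p b) \<noteq> r"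
      using root_notin_branch pb ppb ppbS ppbr[OF prune3(1)] pbV unfolding R_def by auto
    have down: "u \<in> R" if "u \<in> V" "p u \<in> R" for u
      using that prune3(1) branch_down unfolding R_def by auto
    have up: "p u \<in> insert (p (p b)) R" if "u \<in> R" for u
      using that branch_up unfolding R_def by auto
    note pr = prune[OF prem down up]
    have "\<exists>u \<in> V - R. p u = p (p b)"
      using prune3(3) branch_up ppb ppbS unfolding R_def by (metis DiffI insertE)
    then have "psupports (V - R) r p \<subseteq> (psupports V r p - R) \<union> {}"
      using pr(2) by (auto split: if_splits)
    from card_psupports_prune[OF _ this, of 0]
    have s: "card (psupports (V - R) r p) + card forks \<le> card (psupports V r p)"
      unfolding R_def by auto
    have "card R = card branch + 1" using parent_notin_branch finS unfolding R_def by simp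
    then have n: "card (V - R) + 2 * card forks + 2 \<le> card V"
      using card_diff[OF R] cardV[OF R] card_branch by linarith
    obtain X where X: "small_packing (V - R) r p X" using IH[OF pr(1)] n by auto
    then have X': "X \<subseteq> V - branch" "ppacking p X" "p b \<notin> X"
      unfolding small_packing_def R_def by auto
    obtain Y where "Y \<subseteq> V" "X \<subseteq> Y" "ppacking p Y" "pdominates p Y R"
        "card Y \<le> card X + card forks" using extend_by_fork[OF X'] unfolding R_def .
    then have "small_packing V r p Y"
      using X s n dom[of X R Y] unfolding small_packing_def by auto
    then show ?thesis by blast
  next
    case prune4
    define R where "R = insert (p (p b)) (insert (p b) branch)"
    \<comment> \<open>A child of the root is a support vertex, which \<open>p (p b)\<close> is not
      in this case.\<close>
    have pppbr: "p (p (p b)) \<noteq> r"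
      using prune4(2) ppbS pbV ppbr[OF prune4(1)] unfolding psupports_def by auto
    have "p (p (p b)) \<noteq> p (p b)" using parent_neq pbV ppbr[OF prune4(1)] by auto
    moreover have "p (p (p b)) \<noteq> p b"
      using depth_parent_eq[of "p b"] depth_parent_eq[of "p (p b)"] depth_eq_0[of "p b"] pb pbV
      by fastforce
    ultimately have prem: "r \<notin> R" "p (p (p b)) \<in> V - R" "p (p (p b)) \<noteq> r"
      using root_notin_branch pb ppbS ppbr[OF prune4(1)] pbV pppbr unfolding R_def by auto
    have R: "R \<subseteq> V" using SV pbV unfolding R_def by auto
    have down: "u \<in> R" if "u \<in> V" "p u \<in> R" for u
      using that prune4(1,3) branch_down unfolding R_def by auto
    have up: "p u \<in> insert (p (p (p b))) R" if "u \<in> R" for u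
      using that branch_up unfolding R_def by auto
    note pr = prune[OF prem down up]
    have "psupports (V - R) r p \<subseteq> (psupports V r p - R) \<union> {p (p (p (p b)))}"
      using pr(2) by (auto split: if_splits)
    from card_psupports_prune[OF _ this, of 1]
    have s: "card (psupports (V - R) r p) + card forks \<le> card (psupports V r p) + 1"
      unfolding R_def by auto
    have "card R = card branch + 2" using parent_notin_branch ppb ppbS finS unfolding R_def by simp
    then have n: "card (V - R) + 2 * card forks + 3 \<le> card V"
      using card_diff[OF R] cardV[OF R] card_branch by linarith
    obtain X where X: "small_packing (V - R) r p X" using IH[OF pr(1)] n by auto
    then have X': "X \<subseteq> V - branch" "ppacking p X" "p b \<notin> X" "p (p b) \<notin> X"
      unfolding small_packing_def R_def by auto
    have only: "p u \<noteq> p b" if "u \<in> X" for u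
      using X'(1) prune4(1) that by blast
    obtain Y where "Y \<subseteq> V" "X \<subseteq> Y" "ppacking p Y" "pdominates p Y R"
        "card Y \<le> card X + 1" using extend_by_top[OF X' only] unfolding R_def .
    \<comment> \<open>The right-hand side loses at least \<open>(2 t + 3) + 3 (t - 1) = 5 t\<close>,
      and \<open>t\<close> is at least 1, which pays for one new vertex.\<close>
    then have "small_packing V r p Y"
      using X s n t dom[of X R Y] unfolding small_packing_def by auto
    then show ?thesis by blast
  qed
qed

end

section \<open>Existence of a small packing by induction\<close>

context leaf_rooted_tree
begin

text \<open>If all depths were at most 3, the child of the root would be near every vertex. So a
  deepest vertex has depth at least 4, and its grandparent serves as \<open>b\<close>.\<close>

lemma deepest_branch_exists:
  assumes "\<not> (\<exists>x \<in> V. \<forall>v \<in> V. pnear p v x)"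
  obtains b where "deepest_branch V r p h b" "p b \<noteq> r"
proof -
  obtain c where c: "c \<in> V" "c \<noteq> r" "p c = r" using root_leaf by blast
  obtain a where a: "a \<in> V" "\<And>v. v \<in> V \<Longrightarrow> h v \<le> h a"
  proof -
    have "Max (h ` V) \<in> h ` V" using finite_V root_in by (intro Max_in) auto
    then obtain a where "a \<in> V" "h a = Max (h ` V)" by auto
    then show ?thesis using that finite_V by simp
  qed
  have "\<not> h a \<le> 3" using assms pnear_root_child[OF c] c(1) a(2) by (meson le_trans)
  moreover have pa: "p a \<in> V" "p (p a) \<in> V" "p (p (p a)) \<in> V" using a parent_in by auto
  ultimately have ha: "h (p (p a)) = h a - 2" "h (p (p (p a))) = h a - 3" "h a > 3"
    using depth_parent_eq a by auto
  have "deepest_branch V r p h (p (p a))"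
  proof
    show "p (p a) \<in> V" "\<exists>u \<in> V. p (p u) = p (p a)" using pa a by auto
    show "p (p a) \<noteq> r" using ha depth_root by auto
    fix u assume u: "u \<in> V"
    then have "h (p (p (p u))) = h u - 3" using depth_parent_eq parent_in by simp
    then show "p (p (p u)) \<noteq> p (p a)" using a(2)[OF u] ha by auto
  qed
  moreover have "p (p (p a)) \<noteq> r" using ha depth_root by auto
  ultimately show ?thesis using that by blast
qed

end

text \<open>Strong induction on \<open>card V\<close> with \<open>r\<close>, \<open>p\<close> and
  \<open>h\<close> fixed, since pruning changes only the vertex set. The base case is a tree with a
  vertex near all others.\<close>

lemma small_packing_exists:
  assumes "leaf_rooted_tree V r p h"
  shows "\<exists>X. small_packing V r p X"
  using assms
proof (induction "card V" arbitrary: V rule: less_induct)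
  case less
  interpret leaf_rooted_tree V r p h by (rule less.prems)
  show ?case
  proof (cases "\<exists>x \<in> V. \<forall>v \<in> V. pnear p v x")
    case True
    then obtain x where "x \<in> V" "\<forall>v \<in> V. pnear p v x" by blast
    then have "small_packing V r p {x}"
      using six_le_card unfolding small_packing_def ppacking_def pdominates_def by auto
    then show ?thesis by blast
  next
    case False
    then obtain b where b: "deepest_branch V r p h b" "p b \<noteq> r" by (rule deepest_branch_exists)
    interpret deepest_branch V r p h b by (rule b(1))
    show ?thesis using small_packing_step[OF _ b(2) False] less.hyps by blast
  qed
qed

section \<open>Rooting a graph at a leaf\<close>

text \<open>A link between \<open>graph_dist\<close>, an infimum over walks, and the purely local
  \<open>pnear\<close>.\<close>

definition near2 :: "'a pair_pre_digraph \<Rightarrow> 'a \<Rightarrow> 'a \<Rightarrow> bool" where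
  "near2 G u v \<longleftrightarrow> u = v \<or> (u, v) \<in> parcs G \<or> (\<exists>w. (u, w) \<in> parcs G \<and> (w, v) \<in> parcs G)"

lemma (in pair_graph) graph_dist_le_2:
  assumes "u \<in> pverts G" "near2 G u v"
  shows "graph_dist G u v \<le> 2"
proof -
  obtain q where q: "awalk u q v" "length q \<le> 2"
  proof -
    from assms(2) consider "u = v" | "(u, v) \<in> parcs G"
      | w where "(u, w) \<in> parcs G" "(w, v) \<in> parcs G"
      unfolding near2_def by blast
    then show ?thesis
    proof cases
      case 1
      then show ?thesis using that[of "[]"] assms by (simp add: awalk_Nil_iff)
    next
      case 2
      then show ?thesis
        using that[of "[(u, v)]"] by (auto simp: awalk_simps wellformed')
    next
      case 3
      then show ?thesis
        using that[of "[(u, w), (w, v)]"] by (auto simp: awalk_simps wellformed')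
    qed
  qed
  have "graph_dist G u v \<le> ereal (awalk_cost (\<lambda>_. 1) q)"
    unfolding graph_dist_def by (rule min_cost_le_walk_cost[OF q(1)])
  also have "\<dots> \<le> 2" using q(2) by (simp add: awalk_cost_def sum_list_triv)
  finally show ?thesis .
qed

text \<open>Every walk counted by the infimum has at least three arcs, since a shorter one would
  witness \<open>near2\<close>. Without any walk the distance is infinite.\<close>

lemma (in pair_graph) graph_dist_ge_3:
  assumes "\<not> near2 G u v"
  shows "3 \<le> graph_dist G u v"
  unfolding graph_dist_def \<mu>_def
proof (rule INF_greatest)
  fix q assume "q \<in> {q. awalk u q v}"
  then have q: "awalk u q v" by simp
  have "3 \<le> length q"
  proof (rule ccontr)
    assume "\<not> 3 \<le> length q"
    then consider "q = []" | e where "q = [e]" | e f where "q = [e, f]"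
      by (cases q; cases "tl q"; cases "tl (tl q)") auto
    then show False
      using q assms by cases (auto simp: awalk_simps near2_def)
  qed
  then show "3 \<le> ereal (awalk_cost (\<lambda>_. 1) q)"
    by (simp add: awalk_cost_def sum_list_triv)
qed

section \<open>Arc sets of rooted trees\<close>

definition tree_arcs :: "'a set \<Rightarrow> ('a \<Rightarrow> 'a) \<Rightarrow> ('a \<times> 'a) set" where
  "tree_arcs V p = {(u, v). u \<in> V \<and> v \<in> V \<and> u \<noteq> v \<and> (p u = v \<or> p v = u)}"

context rooted_tree
begin

text \<open>Every arc joins a non-root vertex to its parent, in one of two directions; the loop from
  \<open>p r = r\<close> is excluded.\<close>

lemma card_tree_arcs: "card (tree_arcs V p) \<le> 2 * (card V - 1)"
proof -
  let ?W = "V - {r}"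
  have "tree_arcs V p \<subseteq> (\<lambda>v. (v, p v)) ` ?W \<union> (\<lambda>v. (p v, v)) ` ?W"
    unfolding tree_arcs_def using parent_root by auto
  then have "card (tree_arcs V p) \<le> card ((\<lambda>v. (v, p v)) ` ?W \<union> (\<lambda>v. (p v, v)) ` ?W)"
    using finite_V by (intro card_mono) auto
  also have "\<dots> \<le> card ((\<lambda>v. (v, p v)) ` ?W) + card ((\<lambda>v. (p v, v)) ` ?W)"
    by (rule card_Un_le)
  also have "\<dots> \<le> card ?W + card ?W"
    using finite_V by (intro add_mono card_image_le) auto
  finally show ?thesis using root_in finite_V by simp
qed

lemma tree_arcs_from_leaf:
  assumes "u \<in> V" "u \<noteq> r" "\<forall>w \<in> V. p w \<noteq> u"
  shows "{e \<in> tree_arcs V p. fst e = u} = {(u, p u)}"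
  using assms parent_in parent_neq unfolding tree_arcs_def by auto

lemma extend:
  assumes "u \<in> V" "w \<notin> V"
  shows "rooted_tree (insert w V) r (p(w := u)) (h(w := Suc (h u)))"
proof -
  have "w \<noteq> r" "u \<noteq> w" using assms root_in by auto
  moreover have "p v \<noteq> w" if "v \<in> V" for v using parent_in that assms by blast
  ultimately show ?thesis
    using assms finite_V root_in parent_root parent_in depth_root depth_parent
    by unfold_locales auto
qed

lemma tree_arcs_extend:
  assumes "u \<in> V" "w \<notin> V"
  shows "tree_arcs (insert w V) (p(w := u)) = tree_arcs V p \<union> {(u, w), (w, u)}"
proof -
  have "p v \<noteq> w" if "v \<in> V" for v using parent_in that assms by blast
  then show ?thesis using assms unfolding tree_arcs_def by auto
qed

lemma near2_iff_pnear:
  assumes "parcs G = tree_arcs V p" "u \<in> V" "v \<in> V"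
  shows "near2 G u v \<longleftrightarrow> pnear p u v"
proof
  assume "near2 G u v"
  then show "pnear p u v"
    unfolding near2_def pnear_def assms(1) tree_arcs_def by auto
next
  have in_arcs: "(x, y) \<in> parcs G" if "x \<in> V" "y \<in> V" "x \<noteq> y" "p x = y \<or> p y = x" for x y
    using that assms(1) unfolding tree_arcs_def by auto
  \<comment> \<open>Here \<open>z\<close> is a midpoint that may coincide with an end. Each clause
    of \<open>pnear\<close> has \<open>p u\<close> or \<open>p v\<close> as such a midpoint, also at
    the root.\<close>
  have step: "near2 G x y" if "x \<in> V" "y \<in> V" "z \<in> V"
    "z = x \<or> p z = x \<or> p x = z" "z = y \<or> p z = y \<or> p y = z"
    for x y z
    using in_arcs[of x y] in_arcs[of x z] in_arcs[of z y] that unfolding near2_def by metis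
  assume "pnear p u v"
  then show "near2 G u v"
    unfolding pnear_def
    using step[of u v "p u"] step[of u v "p v"] assms(2,3) parent_in by metis
qed

lemma leaf_exists:
  assumes "card V \<ge> 2"
  obtains a where "a \<in> V" "a \<noteq> r" "\<forall>w \<in> V. p w \<noteq> a"
proof -
  have "Max (h ` V) \<in> h ` V" using finite_V root_in by (intro Max_in) auto
  then obtain a where a: "a \<in> V" "h a = Max (h ` V)" by auto
  then have max: "h v \<le> h a" if "v \<in> V" for v using finite_V that by simp
  have "\<exists>v \<in> V. v \<noteq> r"
  proof (rule ccontr)
    assume "\<not> (\<exists>v \<in> V. v \<noteq> r)"
    then have "card V \<le> card {r}" by (intro card_mono) auto
    then show False using assms by simp
  qed
  then obtain v where v: "v \<in> V" "v \<noteq> r" by blast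
  then have "a \<noteq> r" using max[OF v(1)] depth_eq_0[OF v(1)] depth_root by auto
  moreover have "p w \<noteq> a" if "w \<in> V" for w
    using max[OF that] depth_parent[OF that] \<open>a \<noteq> r\<close> parent_root by (cases "w = r") auto
  ultimately show ?thesis using that a by blast
qed

end

section \<open>Growing a rooted subtree until it spans the graph\<close>

context pair_graph
begin

lemma arc_sym: "(u, v) \<in> parcs G \<Longrightarrow> (v, u) \<in> parcs G"
  using pair_sym_arcs unfolding symmetric_def by (auto elim: symE)

text \<open>Parent arcs are followed up to the root and back. Both walks stay inside
  \<open>S\<close>, so a cycle can be closed through a vertex outside \<open>S\<close>.\<close>

lemma awalk_to_root:
  assumes "rooted_tree S r p h" "S \<subseteq> pverts G" "tree_arcs S p \<subseteq> parcs G" "v \<in> S"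
  shows "\<exists>q q'. awalk v q r \<and> awalk r q' v \<and> set q \<subseteq> S \<times> S \<and> set q' \<subseteq> S \<times> S"
  using assms(4)
proof (induction "h v" arbitrary: v)
  case 0
  then have "v = r" using rooted_tree.depth_eq_0[OF assms(1)] by auto
  then have "awalk v [] r" "awalk r [] v" using 0 assms(2) by (auto simp: awalk_Nil_iff)
  then show ?case by (metis empty_set empty_subsetI)
next
  case (Suc k)
  interpret R: rooted_tree S r p h by fact
  have v: "v \<noteq> r" using Suc.hyps(2) R.depth_root by auto
  have pv: "p v \<in> S" "k = h (p v)" using R.parent_in R.depth_parent_eq Suc by auto
  obtain q q' where q: "awalk (p v) q r" "awalk r q' (p v)" "set q \<subseteq> S \<times> S" "set q' \<subseteq> S \<times> S"
    using Suc.hyps(1)[OF pv(2,1)] by blast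
  have "(v, p v) \<in> tree_arcs S p"
    using Suc.prems pv R.parent_neq[OF Suc.prems v] unfolding tree_arcs_def by auto
  then have arc: "(v, p v) \<in> parcs G" using assms(3) by auto
  have "awalk v ((v, p v) # q) r" using q arc by (auto simp: awalk_simps wellformed')
  moreover have "awalk r (q' @ [(p v, v)]) v"
    using q arc_sym[OF arc] by (auto simp: awalk_simps wellformed')
  ultimately show ?case using q pv Suc.prems
    by (intro exI[of _ "(v, p v) # q"] exI[of _ "q' @ [(p v, v)]"]) auto
qed

text \<open>The walk from \<open>u\<close> to \<open>u'\<close> through the root is shortened to a
  path inside \<open>S\<close> and closed through \<open>w\<close>. The path is nonempty as
  \<open>u\<close> and \<open>u'\<close> differ, so the cycle has at least three arcs.\<close>

lemma two_neighbours_cycle: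
  assumes "rooted_tree S r p h" "S \<subseteq> pverts G" "tree_arcs S p \<subseteq> parcs G"
    and "u \<in> S" "u' \<in> S" "u \<noteq> u'" "w \<notin> S" "(u, w) \<in> parcs G" "(u', w) \<in> parcs G"
  shows "\<exists>q. cycle q \<and> 3 \<le> length q"
proof -
  obtain q1 where q1: "awalk u q1 r" "set q1 \<subseteq> S \<times> S"
    using awalk_to_root[OF assms(1-3) assms(4)] by blast
  obtain q2 where q2: "awalk r q2 u'" "set q2 \<subseteq> S \<times> S"
    using awalk_to_root[OF assms(1-3) assms(5)] by blast
  have q12: "awalk u (q1 @ q2) u'" using q1 q2 by auto
  define q where "q = awalk_to_apath (q1 @ q2)"
  have q: "apath u q u'" "set q \<subseteq> S \<times> S"
    using apath_awalk_to_apath[OF q12] awalk_to_apath_subset[OF q12] q1 q2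
    unfolding q_def by auto
  have ne: "q \<noteq> []" using q(1) assms(6) by (auto simp: apath_Nil_iff)
  have aw: "awalk u q u'" "distinct (pawalk_verts u q)"
    using q(1) unfolding apath_def by auto
  have verts: "set (pawalk_verts u q) \<subseteq> S"
    using q(2) assms(4)
  proof (induction q arbitrary: u)
    case (Cons e q)
    then have "snd e \<in> S" "set q \<subseteq> S \<times> S" "fst e \<in> S" by auto
    then show ?case using Cons.IH[of "snd e"] by simp
  qed simp
  let ?c = "(w, u) # q @ [(u', w)]"
  have "awalk w ?c w"
    using aw arc_sym[OF assms(8)] assms(9) by (auto simp: awalk_simps wellformed')
  moreover have "pawalk_verts w ?c = w # pawalk_verts u q @ [w]"
  proof -
    have "pcas u q u'" using aw(1) unfolding awalk_def by simp
    then have "pawalk_verts u (q @ [(u', w)]) = pawalk_verts u q @ [w]"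
      by (induction q arbitrary: u) auto
    then show ?thesis by simp
  qed
  ultimately have "cycle ?c" using aw(2) verts assms(7) unfolding cycle_def by auto
  moreover have "3 \<le> length ?c" using ne by (cases q) auto
  ultimately show ?thesis by blast
qed

text \<open>By symmetry of the arcs, connectedness gives a directed path from \<open>r\<close> to
  \<open>z\<close>, which must leave \<open>S\<close> somewhere.\<close>

lemma boundary_arc:
  assumes "connected (with_proj G)" "r \<in> S" "z \<in> pverts G" "z \<notin> S" "S \<subseteq> pverts G"
  obtains u w where "u \<in> S" "w \<notin> S" "(u, w) \<in> parcs G"
proof -
  have "strongly_connected (with_proj G)"
    using symmetric_connected_imp_strongly_connected[OF pair_sym_arcs assms(1)] .
  then have "r \<rightarrow>\<^sup>*\<^bsub>with_proj G\<^esub> z" using assms unfolding strongly_connected_def by auto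
  from reachable_rtranclI[OF this] have "(r, z) \<in> (parcs G)\<^sup>*" by simp
  then have "\<exists>u w. u \<in> S \<and> w \<notin> S \<and> (u, w) \<in> parcs G"
    using assms(4) by (induction rule: rtrancl_induct) (use assms(2) in auto)
  then show ?thesis using that by blast
qed

end

text \<open>Take a maximal vertex set \<open>S\<close> that induces a tree rooted at
  \<open>r\<close>. If \<open>S\<close> missed a vertex, some \<open>w\<close> outside would have a
  neighbour in \<open>S\<close>, only one by acyclicity, and could be hung below it.\<close>

lemma rooting_exists:
  assumes "graph_tree G" "r \<in> pverts G"
  obtains p h where "rooted_tree (pverts G) r p h" "parcs G = tree_arcs (pverts G) p"
proof -
  interpret pair_graph G using assms unfolding graph_tree_def by auto
  define P where "P S \<longleftrightarrow> S \<subseteq> pverts G \<and>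
    (\<exists>p h. rooted_tree S r p h \<and> parcs G \<inter> S \<times> S = tree_arcs S p)" for S
  have "P {r}"
  proof -
    have "rooted_tree {r} r (\<lambda>_. r) (\<lambda>_. 0)" by unfold_locales auto
    moreover have "parcs G \<inter> {r} \<times> {r} = tree_arcs {r} (\<lambda>_. r)"
      unfolding tree_arcs_def using pair_no_loops by fastforce
    ultimately show ?thesis using assms(2) unfolding P_def by blast
  qed
  moreover have "{S. P S} \<subseteq> Pow (pverts G)" unfolding P_def by auto
  then have "finite {S. P S}" using pair_finite_verts finite_subset by blast
  ultimately obtain S where S: "P S" and maxS: "\<And>S'. P S' \<Longrightarrow> S \<subseteq> S' \<Longrightarrow> S' = S"
    using finite_has_maximal2[of "{S. P S}" "{r}"] by (metis mem_Collect_eq)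
  obtain p h where R: "rooted_tree S r p h" and arcs: "parcs G \<inter> S \<times> S = tree_arcs S p"
    and SV: "S \<subseteq> pverts G"
    using S unfolding P_def by blast
  interpret R: rooted_tree S r p h by (rule R)
  have "S = pverts G"
  proof (rule ccontr)
    assume "S \<noteq> pverts G"
    then obtain z where z: "z \<in> pverts G" "z \<notin> S" using SV by blast
    have conn: "connected (with_proj G)" using assms(1) unfolding graph_tree_def by auto
    obtain u w where uw: "u \<in> S" "w \<notin> S" "(u, w) \<in> parcs G"
      using boundary_arc[OF conn R.root_in z SV] .
    have "tree_arcs S p \<subseteq> parcs G" using arcs by blast
    then have uniq: "u' = u" if "u' \<in> S" "(u', w) \<in> parcs G" for u'
      using two_neighbours_cycle[OF R SV _ uw(1) that(1) _ uw(2,3) that(2)] assms(1)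
      unfolding graph_tree_def by metis
    have "(w, w) \<notin> parcs G" using pair_no_loops[of "(w, w)"] by auto
    moreover have "u' = u" if "u' \<in> S" "(w, u') \<in> parcs G" for u'
      using uniq[OF that(1) arc_sym[OF that(2)]] .
    ultimately have "parcs G \<inter> insert w S \<times> insert w S = parcs G \<inter> S \<times> S \<union> {(u, w), (w, u)}"
      using uniq uw(1) uw(3) arc_sym[OF uw(3)] by blast
    then have "parcs G \<inter> insert w S \<times> insert w S = tree_arcs (insert w S) (p(w := u))"
      unfolding R.tree_arcs_extend[OF uw(1,2)] arcs .
    moreover have "insert w S \<subseteq> pverts G" using SV in_arcsD2[OF uw(3)] by simp
    ultimately have "P (insert w S)"
      using R.extend[OF uw(1,2)] unfolding P_def by metis
    then show False using maxS uw(2) by blast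
  qed
  moreover have "parcs G \<subseteq> pverts G \<times> pverts G" using wellformed' by auto
  ultimately show ?thesis using that[of p h] R arcs by (simp add: Int_absorb2)
qed

text \<open>The tree is rooted twice: at an arbitrary vertex to find a leaf \<open>r\<close>, then
  at \<open>r\<close>, whose only neighbour becomes its only child.\<close>

lemma leaf_rooting_exists:
  assumes "graph_tree G" "card (pverts G) \<ge> 2"
  obtains r p h where "leaf_rooted_tree (pverts G) r p h" "parcs G = tree_arcs (pverts G) p"
proof -
  have "pverts G \<noteq> {}" using assms(2) by auto
  then obtain z where "z \<in> pverts G" by blast
  from rooting_exists[OF assms(1) this] obtain p0 h0
    where R0: "rooted_tree (pverts G) z p0 h0" and arcs0: "parcs G = tree_arcs (pverts G) p0" .
  interpret R0: rooted_tree "pverts G" z p0 h0 by (rule R0)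
  obtain r where r: "r \<in> pverts G" "r \<noteq> z" "\<forall>w \<in> pverts G. p0 w \<noteq> r"
    using R0.leaf_exists[OF assms(2)] .
  have out: "{e \<in> parcs G. fst e = r} = {(r, p0 r)}"
    using R0.tree_arcs_from_leaf[OF r] arcs0 by simp
  from rooting_exists[OF assms(1) r(1)] obtain p h
    where R: "rooted_tree (pverts G) r p h" and arcs: "parcs G = tree_arcs (pverts G) p" .
  interpret R: rooted_tree "pverts G" r p h by (rule R)
  have "(c \<in> pverts G \<and> c \<noteq> r \<and> p c = r) \<longleftrightarrow> (r, c) \<in> parcs G" for c
    unfolding arcs tree_arcs_def using R.parent_root R.root_in by auto
  moreover have "(r, c) \<in> parcs G \<longleftrightarrow> c = p0 r" for c
    using out by (metis (mono_tags, lifting) fst_conv mem_Collect_eq prod.inject singletonD singletonI)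
  ultimately have "\<exists>!c. c \<in> pverts G \<and> c \<noteq> r \<and> p c = r" by simp
  then have "leaf_rooted_tree (pverts G) r p h"
    using R by (simp add: leaf_rooted_tree_def leaf_rooted_tree_axioms_def)
  then show ?thesis using that arcs by blast
qed

section \<open>The bounds\<close>

lemma (in pair_graph) leaf_iff:
  "v \<in> leaves G \<longleftrightarrow> v \<in> pverts G \<and> (\<exists>w. {e \<in> parcs G. fst e = v} = {(v, w)})"
proof -
  have "out_degree (with_proj G) v = 1 \<longleftrightarrow> (\<exists>e. {e \<in> parcs G. fst e = v} = {e})"
    unfolding out_degree_def out_arcs_def by (simp add: card_1_singleton_iff)
  also have "\<dots> \<longleftrightarrow> (\<exists>w. {e \<in> parcs G. fst e = v} = {(v, w)})"
    by (metis (mono_tags, lifting) mem_Collect_eq prod.collapse singletonI)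
  finally show ?thesis unfolding leaves_def by simp
qed

lemma (in pair_graph) other_neighbour:
  assumes "v \<notin> leaves G" "(v, w) \<in> parcs G"
  obtains u where "(v, u) \<in> parcs G" "u \<noteq> w"
proof -
  have "{e \<in> parcs G. fst e = v} \<noteq> {(v, w)}" using assms leaf_iff in_arcsD1 by blast
  then obtain e where "e \<in> parcs G" "fst e = v" "e \<noteq> (v, w)" using assms(2) by auto
  then show ?thesis using that[of "snd e"] by (cases e) auto
qed

lemma (in pair_graph) dominating_set_lower_bound:
  assumes edges: "card (parcs G) \<le> 2 * (card (pverts G) - 1)"
    and X: "X \<subseteq> pverts G" "X \<noteq> {}"
    and dom: "\<And>v. v \<in> pverts G \<Longrightarrow> \<exists>x \<in> X. near2 G v x"
  shows "card (pverts G - leaves G - support_vertices G) + 4 \<le> 5 * card X"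
proof -
  \<comment> \<open>\<open>A1\<close> and \<open>A2\<close> are the vertices at distance 1 and 2 from \<open>X\<close>, \<open>q\<close> moves one step towards \<open>X\<close>,
    and \<open>B\<close> consists of the arcs, in both directions, that \<open>q\<close> does not use.\<close>
  define A1 where "A1 = {v \<in> pverts G - X. \<exists>x \<in> X. (v, x) \<in> parcs G}"
  define A2 where "A2 = pverts G - X - A1"
  have step1: "\<exists>x. x \<in> X \<and> (v, x) \<in> parcs G" if "v \<in> A1" for v
    using that unfolding A1_def by blast
  have step2: "\<exists>x. x \<in> A1 \<and> (v, x) \<in> parcs G" if v: "v \<in> A2" for v
  proof -
    have v': "v \<in> pverts G" "v \<notin> X" "\<And>x. x \<in> X \<Longrightarrow> (v, x) \<notin> parcs G"
      using v unfolding A2_def A1_def by auto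
    obtain x where "x \<in> X" "near2 G v x" using dom v'(1) by blast
    then obtain w where "(v, w) \<in> parcs G" "(w, x) \<in> parcs G"
      using v'(2,3) unfolding near2_def by auto
    moreover have "w \<in> A1"
      using calculation v'(3) \<open>x \<in> X\<close> in_arcsD2 unfolding A1_def by blast
    ultimately show ?thesis by blast
  qed
  define q where "q v = (SOME x. (if v \<in> A1 then x \<in> X else x \<in> A1) \<and> (v, x) \<in> parcs G)" for v
  have q1: "q v \<in> X \<and> (v, q v) \<in> parcs G" if "v \<in> A1" for v
    using someI_ex[OF step1[OF that]] that unfolding q_def by simp
  have q2: "q v \<in> A1 \<and> (v, q v) \<in> parcs G" if "v \<in> A2" for v
  proof -
    have "v \<notin> A1" using that unfolding A2_def by simp
    then show ?thesis using someI_ex[OF step2[OF that]] unfolding q_def by simp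
  qed
  have part: "pverts G - X = A1 \<union> A2" "A1 \<inter> X = {}" "A2 \<inter> X = {}" "A1 \<inter> A2 = {}"
    unfolding A2_def A1_def by auto
  define W where "W = pverts G - X"
  have W: "W = A1 \<union> A2" using part W_def by simp
  have finW: "finite W" unfolding W_def using pair_finite_verts by simp
  define U1 where "U1 = (\<lambda>v. (v, q v)) ` W"
  define U2 where "U2 = (\<lambda>v. (q v, v)) ` W"
  define B where "B = parcs G - (U1 \<union> U2)"
  have q_arc: "(v, q v) \<in> parcs G" if "v \<in> W" for v using that q1 q2 W by blast
  have U_arcs: "U1 \<union> U2 \<subseteq> parcs G"
    unfolding U1_def U2_def using q_arc arc_sym[OF q_arc] by blast
  \<comment> \<open>An arc in both sets would mean two vertices pointing at each other, but
    \<open>q\<close> always moves closer to \<open>X\<close>.\<close>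
  have "U1 \<inter> U2 = {}"
  proof -
    have False if "v \<in> W" "v' \<in> W" "v = q v'" "q v = v'" for v v'
    proof (cases "v \<in> A1")
      case True
      then have "v' \<in> X" using q1 that(4) by blast
      then show False using that(2) unfolding W_def by simp
    next
      case False
      then have "v' \<in> A1" using q2[of v] that(1,4) W by simp
      then have "v \<in> X" using q1[of v'] that(3) by simp
      then show False using that(1) unfolding W_def by simp
    qed
    then show ?thesis unfolding U1_def U2_def by auto
  qed
  then have "card (U1 \<union> U2) = card U1 + card U2"
    using finW unfolding U1_def U2_def by (intro card_Un_disjoint) auto
  also have "card U1 = card W" unfolding U1_def by (intro card_image inj_onI) simp
  also have "card U2 = card W" unfolding U2_def by (intro card_image inj_onI) simp
  finally have cardU: "card (U1 \<union> U2) = 2 * card W" by simp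
  have cardW: "card W = card (pverts G) - card X" "card X \<le> card (pverts G)" "1 \<le> card X"
    using X pair_finite_verts unfolding W_def
    by (auto simp: card_Diff_subset card_mono finite_subset Suc_le_eq card_gt_0_iff)
  have "card B = card (parcs G) - 2 * card W"
    unfolding B_def cardU[symmetric] using U_arcs pair_finite_arcs
    by (intro card_Diff_subset) (auto intro: finite_subset)
  then have cardB: "card B + 2 \<le> 2 * card X" using edges cardW by linarith
  have finB: "finite B" unfolding B_def using pair_finite_arcs by simp
  have B2: "v \<in> fst ` B" if v: "v \<in> A2" "v \<notin> leaves G" for v
  proof -
    obtain u where u: "(v, u) \<in> parcs G" "u \<noteq> q v"
      using other_neighbour[OF v(2)] q2[OF v(1)] by blast
    have "(v, u) \<notin> U2"
    proof
      assume "(v, u) \<in> U2"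
      then have "u \<in> W" "v = q u" unfolding U2_def by auto
      then show False using q1[of u] q2[of u] W part v(1) by blast
    qed
    then have "(v, u) \<in> B" using u unfolding B_def U1_def by auto
    then show ?thesis by force
  qed
  \<comment> \<open>If the second arc of \<open>v\<close> is used, then by some \<open>u\<close> in
    \<open>A2\<close> pointing to \<open>v\<close>. As \<open>v\<close> is no support vertex,
    \<open>u\<close> is no leaf, so \<open>B2\<close> applies to \<open>u\<close>.\<close>
  have B1: "v \<in> fst ` B \<union> q ` fst ` B"
    if v: "v \<in> A1" "v \<notin> leaves G" "v \<notin> support_vertices G" for v
  proof -
    obtain u where u: "(v, u) \<in> parcs G" "u \<noteq> q v"
      using other_neighbour[OF v(2)] q1[OF v(1)] by blast
    show ?thesis
    proof (cases "(v, u) \<in> U2")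
      case False
      then have "(v, u) \<in> B" using u unfolding B_def U1_def by auto
      then show ?thesis by force
    next
      case True
      then have uW: "u \<in> W" "v = q u" unfolding U2_def by auto
      then have "u \<in> A2" using q1[of u] W part v(1) by blast
      moreover have "u \<notin> leaves G"
        using v(3) u(1) in_arcsD1 unfolding support_vertices_def by auto
      ultimately show ?thesis using B2 uW(2) by blast
    qed
  qed
  define I where "I = pverts G - leaves G - support_vertices G"
  have "I \<subseteq> X \<union> (fst ` B \<union> q ` fst ` B)"
    unfolding I_def using B1 B2 part(1) by blast
  then have "card I \<le> card (X \<union> (fst ` B \<union> q ` fst ` B))"
    using finB X(1) pair_finite_verts by (intro card_mono) (auto intro: finite_subset)
  also have "\<dots> \<le> card X + (card (fst ` B) + card (q ` fst ` B))"
    by (meson card_Un_le add_left_mono order_trans)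
  also have "\<dots> \<le> card X + (card B + card B)"
    using finB card_image_le[of B fst] card_image_le[of "fst ` B" q]
    by (intro add_mono) (auto intro: order_trans)
  finally show ?thesis using cardB unfolding I_def by linarith
qed

text \<open>An inclusion serves the upper bound, which grows with the number of support vertices.
  The two parts of \<open>psupports\<close> come from the non-root leaves and from the root as a
  leaf.\<close>

lemma (in pair_graph) psupports_subset_support_vertices:
  assumes "leaf_rooted_tree (pverts G) r p h" and arcs: "parcs G = tree_arcs (pverts G) p"
  shows "psupports (pverts G) r p \<subseteq> support_vertices G"
proof
  interpret R: leaf_rooted_tree "pverts G" r p h by fact
  fix y assume "y \<in> psupports (pverts G) r p"
  then consider (leaf) u where "u \<in> pverts G" "u \<noteq> r" "\<forall>w \<in> pverts G. p w \<noteq> u" "y = p u"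
    | (root) "y \<in> pverts G" "y \<noteq> r" "p y = r"
    unfolding psupports_def by blast
  then show "y \<in> support_vertices G"
  proof cases
    case leaf
    then have "u \<in> leaves G" using R.tree_arcs_from_leaf leaf_iff arcs by metis
    moreover have "(y, u) \<in> parcs G"
      using leaf R.parent_in R.parent_neq[of u] unfolding arcs tree_arcs_def by auto
    ultimately show ?thesis using leaf R.parent_in unfolding support_vertices_def by auto
  next
    case root
    have "c = y" if "c \<in> pverts G" "c \<noteq> r" "p c = r" for c
      using that root R.root_leaf by blast
    then have "{e \<in> parcs G. fst e = r} \<subseteq> {(r, y)}"
      using R.parent_root unfolding arcs tree_arcs_def by auto
    moreover have "(r, y) \<in> parcs G"
      using root R.root_in unfolding arcs tree_arcs_def by auto
    ultimately have "{e \<in> parcs G. fst e = r} = {(r, y)}" by auto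
    then have "r \<in> leaves G" using leaf_iff R.root_in by blast
    moreover have "(y, r) \<in> parcs G"
      using root R.root_in unfolding arcs tree_arcs_def by auto
    ultimately show ?thesis using root unfolding support_vertices_def by auto
  qed
qed

theorem theorem1p4:
  fixes T :: "'a pair_pre_digraph" and n l s :: nat
  assumes "graph_tree T"
    and "n = card (pverts T)"
    and "n \<ge> 2"
    and "l = card (leaves T)"
    and "s = card (support_vertices T)"
  shows "\<lceil>(real n - real l - real s + 4) / 5\<rceil> \<le> int (gamma_2_2 T)
       \<and> int (gamma_2_2 T) \<le> \<lfloor>(real n + 3 * real s - 1) / 5\<rfloor>"
proof -
  interpret pair_graph T using assms(1) unfolding graph_tree_def by auto
  obtain r p h where R: "leaf_rooted_tree (pverts T) r p h"
    and arcs: "parcs T = tree_arcs (pverts T) p"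
    using leaf_rooting_exists[OF assms(1)] assms(2,3) by blast
  interpret R: leaf_rooted_tree "pverts T" r p h by (rule R)
  have fin: "finite (leaves T)" "finite (support_vertices T)"
    using pair_finite_verts unfolding leaves_def support_vertices_def by auto
  define F where "F = {X. X \<subseteq> pverts T \<and> dominating_within_2 T X \<and> two_packing T X}"
  have "F \<subseteq> Pow (pverts T)" unfolding F_def by auto
  then have finF: "finite F" using pair_finite_verts finite_subset by blast
  have gamma: "gamma_2_2 T = Min (card ` F)" unfolding gamma_2_2_def F_def ..
  have le2: "near2 T u v" if "graph_dist T u v \<le> 2" for u v
  proof (rule ccontr)
    assume "\<not> near2 T u v"
    then have "(3::ereal) \<le> 2" using graph_dist_ge_3 that order_trans by blast
    then show False by simp
  qed
  obtain X where X: "small_packing (pverts T) r p X"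
    using small_packing_exists[OF R] by blast
  have "X \<in> F"
  proof -
    have XV: "X \<subseteq> pverts T" using X unfolding small_packing_def by auto
    have "dominating_within_2 T X"
      unfolding dominating_within_2_def
    proof
      fix v assume "v \<in> pverts T - X"
      then have v: "v \<in> pverts T" by simp
      then obtain x where x: "x \<in> X" "pnear p v x"
        using X unfolding small_packing_def pdominates_def by blast
      then have "near2 T v x" using R.near2_iff_pnear[OF arcs v] XV by blast
      then show "\<exists>x \<in> X. graph_dist T v x \<le> 2" using x(1) graph_dist_le_2[OF v] by blast
    qed
    moreover have "two_packing T X"
      unfolding two_packing_def
    proof (intro ballI impI)
      fix x y assume xy: "x \<in> X" "y \<in> X" "x \<noteq> y"
      then have "\<not> pnear p x y" using X unfolding small_packing_def ppacking_def by blast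
      then have "\<not> near2 T x y" using R.near2_iff_pnear[OF arcs] XV xy by blast
      then show "3 \<le> graph_dist T x y" by (rule graph_dist_ge_3)
    qed
    ultimately show ?thesis using XV unfolding F_def by blast
  qed
  then have "gamma_2_2 T \<le> card X" unfolding gamma using finF by auto
  moreover have "card (psupports (pverts T) r p) \<le> s"
    unfolding assms(5) using psupports_subset_support_vertices[OF R arcs] fin by (intro card_mono)
  ultimately have upper: "5 * gamma_2_2 T + 1 \<le> n + 3 * s"
    using X assms(2) unfolding small_packing_def by linarith
  \<comment> \<open>The packing \<open>X\<close> shows that \<open>F\<close> is nonempty, so the
    minimum is attained.\<close>
  have "gamma_2_2 T \<in> card ` F" unfolding gamma using finF \<open>X \<in> F\<close> by (intro Min_in) auto
  then obtain Y where Y: "Y \<in> F" "gamma_2_2 T = card Y" by blast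
  have domY: "\<exists>y \<in> Y. near2 T v y" if "v \<in> pverts T" for v
  proof (cases "v \<in> Y")
    case True
    then show ?thesis unfolding near2_def by blast
  next
    case False
    then show ?thesis using Y(1) that le2 unfolding F_def dominating_within_2_def by blast
  qed
  have "Y \<noteq> {}" using domY R.root_in by blast
  then have "card (pverts T - leaves T - support_vertices T) + 4 \<le> 5 * gamma_2_2 T"
    using dominating_set_lower_bound[OF _ _ _ domY] R.card_tree_arcs arcs Y
    unfolding F_def by auto
  \<comment> \<open>A union bound, valid also when leaves and support vertices overlap, as on two
    vertices.\<close>
  moreover have "n \<le> l + s + card (pverts T - leaves T - support_vertices T)"
    using assms(2,4,5) diff_card_le_card_Diff[OF fin(1), of "pverts T"]
      diff_card_le_card_Diff[OF fin(2), of "pverts T - leaves T"] by linarith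
  ultimately have lower: "n + 4 \<le> 5 * gamma_2_2 T + l + s" by linarith
  have "(real n - real l - real s + 4) / 5 \<le> real (gamma_2_2 T)" using lower by simp
  moreover have "real (gamma_2_2 T) \<le> (real n + 3 * real s - 1) / 5" using upper by simp
  ultimately show ?thesis by (simp add: ceiling_le_iff le_floor_iff)
qed

end
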